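(* Let $p>0$ and, for each integer $n>2$, let $A_n$ be the area of the regular $n$-gon of perimeter $p$. Let $A_{\mathrm{circle}}=\frac{p^2}{4\pi}$ be the area enclosed by the circle of perimeter $p$, and let $W_n = A_{\mathrm{circle}}-A_n$. Then for every integer $n>2$, $$W_n=\frac{p^2}{4}\left[\frac1\pi-\frac{1}{n\tan(\pi/n)}\right]\qquad\text{and}\qquad A_n<A_{\mathrm{circle}},$$ and moreover $$\lim_{n\to\infty}W_n=0,\qquad \lim_{n\to\infty}A_n=\frac{p^2}{4\pi}.$$
   Context: The quantity $W_n$ is called the wasted area of the regular $n$-gon: the difference between the area of the disc whose boundary has length $p$ and the area of the regular $n$-gon with the same perimeter $p$ (each side having length $p/n$). *)

theory Defs
  imports "HOL-Complex_Analysis.Complex_Analysis"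
begin

text \<open>
  The plane is \<^typ>\<open>complex\<close>. A polygon with \<open>n\<close> vertices is given by the cyclic sequence
  \<open>v 0, \<dots>, v (n - 1)\<close> of its vertices; values of \<open>v\<close> beyond that are irrelevant.
  The centre \<open>c\<close>, circumradius \<open>R\<close> and rotation \<open>\<theta>\<close> of a regular polygon are arbitrary.
\<close>

definition regular_polygon :: "nat \<Rightarrow> (nat \<Rightarrow> complex) \<Rightarrow> bool" where
  "regular_polygon n v \<longleftrightarrow>
     n > 2 \<and>
     (\<exists>c R \<theta>. R > 0 \<and> (\<forall>k<n. v k = c + of_real R * cis (\<theta> + 2 * pi * real k / real n)))"

definition polygon_perimeter :: "nat \<Rightarrow> (nat \<Rightarrow> complex) \<Rightarrow> real" where
  "polygon_perimeter n v = (\<Sum>k<n. dist (v k) (v (Suc k mod n)))"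

text \<open>
  For vertices in convex position, as in a regular polygon, the region enclosed is the convex hull.
\<close>

definition convex_polygon_area :: "nat \<Rightarrow> (nat \<Rightarrow> complex) \<Rightarrow> real" where
  "convex_polygon_area n v = measure lebesgue (convex hull (v ` {..<n}))"

text \<open>The length of a continuously differentiable curve parametrised by the unit interval.\<close>

definition curve_length :: "(real \<Rightarrow> complex) \<Rightarrow> real" where
  "curve_length g = integral {0..1} (\<lambda>t. norm (vector_derivative g (at t)))"

text \<open>Regular polygons and circles of every positive perimeter exist.\<close>

lemma ex_regular_polygon_perimeter:
  assumes "n > 2" and "p > 0"
  shows "\<exists>v. regular_polygon n v \<and> polygon_perimeter n v = p"
proof -
  define u where "u k = cis (2 * pi * real k / real n)" for k
  define q where "q = polygon_perimeter n u"
  have "u 0 \<noteq> u 1"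
  proof
    assume "u 0 = u 1"
    then have "cos (2 * pi / real n) = 1"
      by (simp add: u_def complex_eq_iff)
    moreover have "cos (2 * pi / real n) < cos 0"
      using assms by (intro cos_monotone_0_pi) (auto simp: field_simps)
    ultimately show False by simp
  qed
  then have "dist (u 0) (u (Suc 0 mod n)) > 0"
    using assms by simp
  then have q: "q > 0"
    unfolding q_def polygon_perimeter_def using assms
    by (intro sum_pos2[of _ 0]) auto
  define v where "v k = of_real (p / q) * u k" for k
  have "regular_polygon n v"
    unfolding regular_polygon_def v_def u_def using assms q
    by (intro conjI exI[of _ 0] exI[of _ "p / q"]) auto
  moreover have "polygon_perimeter n v = (p / q) * q"
  proof -
    have "dist (v i) (v j) = (p / q) * dist (u i) (u j)" for i j
    proof -
      have "v i - v j = of_real (p / q) * (u i - u j)"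
        by (simp add: v_def right_diff_distrib)
      then have "norm (v i - v j) = \<bar>p / q\<bar> * norm (u i - u j)"
        by (simp only: norm_mult norm_of_real)
      then show ?thesis
        using assms q by (simp add: dist_norm)
    qed
    then show ?thesis
      by (simp add: polygon_perimeter_def q_def sum_distrib_left)
  qed
  ultimately show ?thesis
    using q by auto
qed

lemma curve_length_circlepath:
  assumes "r > 0"
  shows "curve_length (circlepath c r) = 2 * pi * r"
  using assms by (simp add: curve_length_def vector_derivative_circlepath norm_mult)

end

theory Submission
  imports Defs "HOL-Real_Asymp.Real_Asymp"
begin

text \<open>
  The regular polygon is the union of the \<open>n\<close> triangles spanned by its centre and its sides.
  Two of these lie on opposite sides of a line through the centre, so their areas
  \<open>R\<^sup>2 sin (2\<pi>/n) / 2\<close> add up. Eliminating the circumradius \<open>R\<close> by means of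
  \<open>p = 2nR sin (\<pi>/n)\<close> gives \<open>A\<^sub>n = p\<^sup>2 / (4n tan (\<pi>/n))\<close>, and the
  comparison with the circle is \<open>\<pi>/n < tan (\<pi>/n)\<close>.
\<close>

section \<open>Area of a triangle in the complex plane\<close>

text \<open>The coordinate map \<open>f\<close> to \<open>real^2\<close> preserves Lebesgue measure
  and convex hulls, so \<open>content_triangle\<close> transfers; the numerator is the absolute
  determinant of the two edge vectors at \<open>a\<close>.\<close>

lemma measure_convex_hull_triangle_complex:
  fixes a b c :: complex
  shows "measure lebesgue (convex hull {a, b, c}) =
    \<bar>Re (b - a) * Im (c - a) - Im (b - a) * Re (c - a)\<bar> / 2"
proof -
  \<comment> \<open>The library has the area of a triangle only in \<^typ>\<open>real^2\<close>.\<close>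
  define f :: "complex \<Rightarrow> real^2" where "f z = vector [Re z, Im z]" for z
  have f1 [simp]: "f z $ 1 = Re z" and f2 [simp]: "f z $ 2 = Im z" for z
    by (simp_all add: f_def)
  have lin: "linear f"
    by (rule linearI) (simp_all add: vec_eq_iff forall_2)
  have inj: "inj f"
    by (auto simp: inj_def vec_eq_iff forall_2 complex_eq_iff)
  have meas: "f \<in> borel_measurable borel"
    using linear_continuous_on[OF lin[unfolded linear_conv_bounded_linear]]
    by (rule borel_measurable_continuous_onI)
  \<comment> \<open>A Borel measure that gives every box its volume is \<open>lborel\<close>, and
    the preimage of a box under \<open>f\<close> is the box with the same corner
    coordinates.\<close>
  have distr: "lborel = distr lborel borel f"
  proof (rule lborel_eqI)
    fix l u :: "real^2" assume le: "\<And>b. b \<in> Basis \<Longrightarrow> l \<bullet> b \<le> u \<bullet> b"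
    have le': "l $ i \<le> u $ i" for i
      using le[of "axis i 1"] by (simp add: inner_axis axis_in_Basis_iff)
    have "f -` box l u = box (Complex (l $ 1) (l $ 2)) (Complex (u $ 1) (u $ 2))"
      by (auto simp: mem_box_cart forall_2 in_box_complex_iff)
    then have "emeasure (distr lborel borel f) (box l u)
        = emeasure lborel (box (Complex (l $ 1) (l $ 2)) (Complex (u $ 1) (u $ 2)))"
      using meas by (simp add: emeasure_distr)
    also have "\<dots> = (\<Prod>b\<in>Basis. (Complex (u $ 1) (u $ 2) - Complex (l $ 1) (l $ 2)) \<bullet> b)"
      using le' by (intro emeasure_lborel_box) (auto simp: Basis_complex_def)
    also have "(\<Prod>b\<in>Basis. (Complex (u $ 1) (u $ 2) - Complex (l $ 1) (l $ 2)) \<bullet> b)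
        = (u $ 1 - l $ 1) * (u $ 2 - l $ 2)"
      by (simp add: Basis_complex_def)
    also have "\<dots> = (\<Prod>b\<in>Basis. (u - l) \<bullet> b)"
      by (simp add: Basis_vec_def prod.UNION_disjoint UNION_singleton_eq_range
          prod.reindex inj_on_def axis_eq_axis inner_axis UNIV_2)
    finally show "emeasure (distr lborel borel f) (box l u) = (\<Prod>b\<in>Basis. (u - l) \<bullet> b)" .
  qed simp
  have compact: "compact (convex hull {x, y, z})" for x y z :: "'a :: euclidean_space"
    by (intro finite_imp_compact_convex_hull) auto
  have "f ` (convex hull {a, b, c}) = convex hull {f a, f b, f c}"
    using convex_hull_linear_image[OF lin, of "{a, b, c}"] by simp
  \<comment> \<open>Injectivity turns the image into a preimage, the form that
    \<open>measure_distr\<close> evaluates.\<close>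
  then have "convex hull {a, b, c} = f -` (convex hull {f a, f b, f c})"
    using inj by (metis inj_vimage_image_eq)
  then have "measure lborel (convex hull {a, b, c})
      = measure (distr lborel borel f) (convex hull {f a, f b, f c})"
    using meas compact_imp_closed[OF compact, of "f a" "f b" "f c"]
    by (subst measure_distr) auto
  also have "\<dots> = \<bar>Re (b - a) * Im (c - a) - Im (b - a) * Re (c - a)\<bar> / 2"
    unfolding distr[symmetric] content_triangle by (simp add: abs_minus_commute mult.commute)
  finally show ?thesis
    using compact_imp_closed[OF compact, of a b c] by simp
qed

section \<open>Trigonometric preliminaries\<close>

text \<open>Cosine is even, decreasing on [0, pi] and symmetric about pi, so an angle that stays at
  least \<open>h\<close> away from 0 and from 2 pi cannot have a larger cosine than
  \<open>h\<close>.\<close>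

lemma cos_le_cos_of_le_abs:
  assumes "0 \<le> h" "h \<le> \<bar>x\<bar>" "\<bar>x\<bar> \<le> 2 * pi - h"
  shows "cos x \<le> cos h"
proof (cases "\<bar>x\<bar> \<le> pi")
  case True
  then show ?thesis
    using cos_monotone_0_pi_le[of h "\<bar>x\<bar>"] assms by simp
next
  case False
  then have "cos (2 * pi - \<bar>x\<bar>) \<le> cos h"
    using assms by (intro cos_monotone_0_pi_le) auto
  then show ?thesis
    by (simp add: cos_diff)
qed

lemma inner_cis_cis: "cis a \<bullet> cis b = cos (b - a)"
  by (simp add: inner_complex_def cos_diff)

lemma inner_ii_cis_cis: "(\<i> * cis a) \<bullet> cis b = sin (b - a)"
  by (simp add: inner_complex_def sin_diff)

text \<open>A geometric sum over powers of a root of unity \<open>w\<close> other than 1. It shows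
  that the centre is the mean of the vertices.\<close>

lemma sum_cis_regular:
  assumes "n > 1"
  shows "(\<Sum>k<n. cis (\<theta> + 2 * pi * real k / real n)) = 0"
proof -
  define w where "w = cis (2 * pi / real n)"
  have "w \<noteq> 1"
  proof
    assume "w = 1"
    then have "cos (2 * pi / real n) = cos 0"
      by (simp add: w_def complex_eq_iff)
    \<comment> \<open>The remaining case \<open>n = 2\<close> is settled by cos pi = -1.\<close>
    moreover have "cos (2 * pi / real n) < cos 0" if "n > 2"
      using that by (intro cos_monotone_0_pi) (auto simp: field_simps)
    ultimately show False
      using assms by (cases "n = 2") auto
  qed
  have "(\<Sum>k<n. cis (\<theta> + 2 * pi * real k / real n)) = cis \<theta> * (\<Sum>k<n. w ^ k)"
    by (simp add: sum_distrib_left w_def Complex.DeMoivre cis_mult mult_ac)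
  also have "(\<Sum>k<n. w ^ k) = (w ^ n - 1) / (w - 1)"
    using \<open>w \<noteq> 1\<close> by (rule geometric_sum)
  also have "w ^ n = 1"
    using assms by (simp add: w_def Complex.DeMoivre)
  finally show ?thesis by simp
qed

text \<open>Cramer's rule for a direction in the basis \<open>cis a\<close>,
  \<open>cis (a + d)\<close>. For 0 \<le> u \<le> d < pi both coefficients are nonnegative, so the
  direction lies in the cone of the two.\<close>

lemma cis_cone_decomposition:
  assumes "sin d \<noteq> 0"
  shows "cis (a + u) = of_real (sin (d - u) / sin d) * cis a + of_real (sin u / sin d) * cis (a + d)"
proof -
  have "sin d * cos (a + u) = sin (d - u) * cos a + sin u * cos (a + d)"
    and "sin d * sin (a + u) = sin (d - u) * sin a + sin u * sin (a + d)"
    by (simp_all add: sin_add sin_diff cos_add algebra_simps)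
  then show ?thesis
    using assms by (simp add: complex_eq_iff field_simps)
qed

section \<open>Decomposition of the polygon into central triangles\<close>

text \<open>The index \<open>k\<close> is unrestricted: index \<open>n\<close> gives vertex 0 again,
  so the last side needs no reduction modulo \<open>n\<close>.\<close>

definition regular_vertex :: "complex \<Rightarrow> real \<Rightarrow> real \<Rightarrow> nat \<Rightarrow> nat \<Rightarrow> complex" where
  "regular_vertex c R \<theta> n k = c + of_real R * cis (\<theta> + 2 * pi * real k / real n)"

definition central_triangle :: "complex \<Rightarrow> real \<Rightarrow> real \<Rightarrow> nat \<Rightarrow> nat \<Rightarrow> complex set" where
  "central_triangle c R \<theta> n k =
    convex hull {c, regular_vertex c R \<theta> n k, regular_vertex c R \<theta> n (Suc k)}"

lemma regular_vertex_mod: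
  assumes "k < n"
  shows "regular_vertex c R \<theta> n (Suc k mod n) = regular_vertex c R \<theta> n (Suc k)"
proof (cases "Suc k = n")
  case True
  then show ?thesis
    using assms cis_mult[of \<theta> "2 * pi"] by (simp add: regular_vertex_def)
next
  case False
  then show ?thesis using assms by simp
qed

lemma measure_central_triangle:
  assumes "n > 2"
  shows "measure lebesgue (central_triangle c R \<theta> n k) = R\<^sup>2 * sin (2 * pi / n) / 2"
proof -
  define a where "a = \<theta> + 2 * pi * real k / real n"
  define b where "b = \<theta> + 2 * pi * real (Suc k) / real n"
  have "b - a = 2 * pi / n"
    using assms by (simp add: a_def b_def field_simps)
  moreover have "sin (2 * pi / n) \<ge> 0"
    using assms by (intro sin_ge_zero) (auto simp: field_simps)
  moreover have "R * cos a * (R * sin b) - R * sin a * (R * cos b) = R\<^sup>2 * sin (b - a)"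
    by (simp add: sin_diff power2_eq_square algebra_simps)
  ultimately show ?thesis
    by (simp add: central_triangle_def regular_vertex_def measure_convex_hull_triangle_complex
        del: of_nat_Suc flip: a_def b_def)
qed

lemma negligible_central_triangle_Int:
  assumes "j < k" "k < n" "R > 0"
  shows "negligible (central_triangle c R \<theta> n j \<inter> central_triangle c R \<theta> n k)"
proof -
  \<comment> \<open>The separating line has the direction halfway between the vertices \<open>j + 1\<close> and \<open>k\<close>.\<close>
  define \<phi> where "\<phi> = \<theta> + pi * real (j + k + 1) / real n"
  define a where "a = \<i> * cis \<phi>"
  have v: "a \<bullet> regular_vertex c R \<theta> n i = a \<bullet> c + R * sin (pi * (2 * real i - (real j + real k + 1)) / n)" for i
  proof -
    have "a \<bullet> regular_vertex c R \<theta> n i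
        = a \<bullet> c + R * (a \<bullet> cis (\<theta> + 2 * pi * real i / real n))"
      by (simp add: regular_vertex_def inner_add_right flip: scaleR_conv_of_real)
    also have "a \<bullet> cis (\<theta> + 2 * pi * real i / real n)
        = sin (\<theta> + 2 * pi * real i / real n - \<phi>)"
      by (simp add: a_def inner_ii_cis_cis)
    also have "\<theta> + 2 * pi * real i / real n - \<phi> = pi * (2 * real i - (real j + real k + 1)) / n"
      using assms by (simp add: \<phi>_def field_simps)
    finally show ?thesis .
  qed
  \<comment> \<open>Measured from the line in units of pi/n, the vertices of triangle
    \<open>k\<close> have angles k - j - 1 and k - j + 1, those of triangle \<open>j\<close> the
    negatives. Since j < k < n, the former lie between 0 and n.\<close>
  have pos: "sin (pi * t / n) \<ge> 0" if "0 \<le> t" "t \<le> n" for t :: real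
    using that assms by (intro sin_ge_zero) (auto simp: field_simps)
  have neg: "sin (pi * t / n) \<le> 0" if "t \<le> 0" "- t \<le> n" for t :: real
    using pos[of "-t"] that by simp
  have "central_triangle c R \<theta> n j \<subseteq> {z. a \<bullet> z \<le> a \<bullet> c}"
    unfolding central_triangle_def using assms
    by (intro hull_minimal convex_halfspace_le)
      (auto simp: v intro!: mult_nonneg_nonpos neg)
  moreover have "central_triangle c R \<theta> n k \<subseteq> {z. a \<bullet> z \<ge> a \<bullet> c}"
    unfolding central_triangle_def using assms
    by (intro hull_minimal convex_halfspace_ge) (auto simp: v intro!: mult_nonneg_nonneg pos)
  ultimately have "central_triangle c R \<theta> n j \<inter> central_triangle c R \<theta> n k \<subseteq> {z. a \<bullet> z = a \<bullet> c}"
    by fastforce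
  moreover have "negligible {z. a \<bullet> z = a \<bullet> c}"
    by (intro negligible_hyperplane) (simp add: a_def)
  ultimately show ?thesis
    by (rule negligible_subset[rotated])
qed

text \<open>The polygon lies on the inner side of the line through its \<open>k\<close>-th side.\<close>

lemma regular_hull_inner_le:
  assumes "k < n" "R > 0" "z \<in> convex hull (regular_vertex c R \<theta> n ` {..<n})"
  shows "cis (\<theta> + pi * (2 * k + 1) / n) \<bullet> (z - c) \<le> R * cos (pi / n)"
proof -
  \<comment> \<open>The outer unit normal of the side, pointing to the angle halfway between its
    endpoints.\<close>
  define a where "a = cis (\<theta> + pi * (2 * k + 1) / n)"
  have "a \<bullet> regular_vertex c R \<theta> n j \<le> a \<bullet> c + R * cos (pi / n)" if "j < n" for j
  proof -
    have "a \<bullet> regular_vertex c R \<theta> n j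
        = a \<bullet> c + R * (a \<bullet> cis (\<theta> + 2 * pi * real j / real n))"
      by (simp add: regular_vertex_def inner_add_right flip: scaleR_conv_of_real)
    also have "a \<bullet> cis (\<theta> + 2 * pi * real j / real n)
        = cos (\<theta> + 2 * pi * real j / real n - (\<theta> + pi * (2 * k + 1) / n))"
      by (simp add: a_def inner_cis_cis)
    also have "\<theta> + 2 * pi * real j / real n - (\<theta> + pi * (2 * k + 1) / n)
        = pi / n * (2 * real j - 2 * real k - 1)"
      using assms by (simp add: field_simps)
    also have "cos (pi / n * (2 * real j - 2 * real k - 1)) \<le> cos (pi / n)"
    proof (rule cos_le_cos_of_le_abs)
      \<comment> \<open>An odd integer is nonzero, hence at least 1 in absolute value; the upper
        bound is attained for j = 0 and k = n - 1.\<close>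
      have "1 \<le> \<bar>2 * real j - 2 * real k - 1\<bar>" "\<bar>2 * real j - 2 * real k - 1\<bar> \<le> 2 * real n - 1"
        using assms that by (cases "j \<le> k"; simp)+
      then have "pi / n * 1 \<le> pi / n * \<bar>2 * real j - 2 * real k - 1\<bar>"
          "pi / n * \<bar>2 * real j - 2 * real k - 1\<bar> \<le> pi / n * (2 * real n - 1)"
        by (intro mult_left_mono; simp)+
      moreover have "pi / n * (2 * real n - 1) = 2 * pi - pi / n"
        using assms by (simp add: field_simps)
      moreover have "\<bar>pi / n * (2 * real j - 2 * real k - 1)\<bar>
          = pi / n * \<bar>2 * real j - 2 * real k - 1\<bar>"
        by (simp only: abs_mult) simp
      ultimately show "pi / n \<le> \<bar>pi / n * (2 * real j - 2 * real k - 1)\<bar>"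
          "\<bar>pi / n * (2 * real j - 2 * real k - 1)\<bar> \<le> 2 * pi - pi / n"
        by (simp_all only: mult_1_right)
    qed simp
    finally show ?thesis
      using assms by simp
  qed
  then have "convex hull (regular_vertex c R \<theta> n ` {..<n}) \<subseteq> {z. a \<bullet> z \<le> a \<bullet> c + R * cos (pi / n)}"
    by (intro hull_minimal convex_halfspace_le) auto
  with assms(3) have "a \<bullet> z \<le> a \<bullet> c + R * cos (pi / n)"
    by blast
  then show ?thesis
    unfolding a_def[symmetric] by (simp add: inner_diff_right)
qed

text \<open>The hull contains the centre, hence every central triangle. Conversely, the polar angle
  of a point about \<open>c\<close> selects a sector; there the point has nonnegative coordinates
  \<open>x\<close>, \<open>y\<close> along the two radii, and the inequality for the side of that
  sector says exactly x + y \<le> 1.\<close>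

lemma convex_hull_regular_eq:
  assumes "n > 2" "R > 0"
  shows "convex hull (regular_vertex c R \<theta> n ` {..<n}) = (\<Union>k<n. central_triangle c R \<theta> n k)"
    (is "?H = ?U")
proof
  let ?v = "regular_vertex c R \<theta> n"
  have sum: "(\<Sum>k<n. cis (\<theta> + 2 * pi * real k / real n)) = 0"
    using assms by (intro sum_cis_regular) simp
  have "(\<Sum>k<n. (1 / n) *\<^sub>R ?v k) \<in> ?H"
    using assms by (intro convex_sum) (auto intro: hull_inc)
  also have "(\<Sum>k<n. (1 / n) *\<^sub>R ?v k) = c"
    using assms sum
    by (simp add: regular_vertex_def sum.distrib flip: scaleR_sum_right sum_distrib_left)
      (simp add: scaleR_conv_of_real)
  finally have c: "c \<in> ?H" .
  have v: "?v k \<in> ?H" if "k < n" for k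
    using that by (intro hull_inc) auto
  have v': "?v (Suc k) \<in> ?H" if "k < n" for k
    using v[of "Suc k mod n"] regular_vertex_mod[OF that] that by simp
  show "?U \<subseteq> ?H"
    unfolding central_triangle_def using c v v'
    by (intro UN_least hull_minimal) auto
  show "?H \<subseteq> ?U"
  proof
    fix z assume z: "z \<in> ?H"
    define \<delta> where "\<delta> = 2 * pi / n"
    have \<delta>: "0 < \<delta>" "\<delta> < pi" "real n * \<delta> = 2 * pi"
      using assms by (auto simp: \<delta>_def field_simps)
    \<comment> \<open>The polar angle of \<open>z\<close> about \<open>c\<close>, counted from
      vertex 0. For z = c the radius \<open>s\<close> is 0, so the polar form holds there
      too.\<close>
    define t where "t = Arg2pi ((z - c) / cis \<theta>)"
    define s where "s = norm (z - c)"
    have t: "0 \<le> t" "t < 2 * pi"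
      by (auto simp: t_def Arg2pi_ge_0 Arg2pi_lt_2pi)
    have "(z - c) / cis \<theta> = of_real s * cis t"
      using Arg2pi_eq[of "(z - c) / cis \<theta>"] by (simp add: t_def s_def norm_divide cis_conv_exp)
    then have zt: "z - c = of_real s * cis (\<theta> + t)"
      by (simp add: field_simps flip: cis_mult)
    \<comment> \<open>The sector of angle \<open>\<delta>\<close> that contains \<open>t\<close>; t
      < 2 pi ensures k < n.\<close>
    define k where "k = nat \<lfloor>t / \<delta>\<rfloor>"
    have "real k \<le> t / \<delta>" "t / \<delta> < real k + 1"
      using t \<delta> unfolding k_def by (auto intro!: of_nat_floor)
    moreover have "t / \<delta> < n"
      using t \<delta> by (simp add: field_simps)
    ultimately have k: "k < n" "k * \<delta> \<le> t" "t \<le> (real k + 1) * \<delta>"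
      using \<delta>(1) by (linarith, simp_all add: pos_le_divide_eq pos_divide_less_eq)
    define u where "u = t - k * \<delta>"
    have u: "0 \<le> u" "u \<le> \<delta>"
      using k by (auto simp: u_def algebra_simps)
    have sin: "sin \<delta> > 0"
      using \<delta> by (intro sin_gt_zero)
    \<comment> \<open>The coefficients of \<open>cis_cone_decomposition\<close>, rescaled from
      length 1 to \<open>s\<close> and from unit vectors to radii of length
      \<open>R\<close>.\<close>
    define x where "x = s * sin (\<delta> - u) / (R * sin \<delta>)"
    define y where "y = s * sin u / (R * sin \<delta>)"
    have xy: "x \<ge> 0" "y \<ge> 0"
      unfolding x_def y_def s_def using u \<delta> sin assms
      by (auto intro!: divide_nonneg_pos mult_nonneg_nonneg sin_ge_zero)
    define \<alpha> where "\<alpha> = \<theta> + 2 * pi * real k / real n"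
    have vk: "?v k = c + of_real R * cis \<alpha>"
      by (simp add: regular_vertex_def \<alpha>_def)
    have vk': "?v (Suc k) = c + of_real R * cis (\<alpha> + \<delta>)"
      using assms by (simp add: regular_vertex_def \<alpha>_def \<delta>_def field_simps)
    have "\<theta> + t = \<alpha> + u"
      by (simp add: \<alpha>_def u_def \<delta>_def)
    then have zc: "z - c = x *\<^sub>R (?v k - c) + y *\<^sub>R (?v (Suc k) - c)"
      unfolding zt vk vk' x_def y_def using cis_cone_decomposition[of \<delta> \<alpha> u] sin assms
      by (simp add: scaleR_conv_of_real ring_distribs)
    \<comment> \<open>Both endpoints of the side have the same component along its normal, the
      apothem R cos (pi/n), so the inner product is x + y times the apothem. The apothem is positive
      and cancels.\<close>
    have "cis (\<alpha> + \<delta> / 2) \<bullet> (z - c) \<le> R * cos (pi / n)"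
      using regular_hull_inner_le[OF k(1) assms(2) z]
      by (simp add: \<alpha>_def \<delta>_def add_divide_distrib ring_distribs mult_ac add_ac)
    also have "cis (\<alpha> + \<delta> / 2) \<bullet> (z - c) = (x + y) * (R * cos (\<delta> / 2))"
      unfolding zc vk vk' using assms
      by (simp add: inner_add_right inner_cis_cis ring_distribs flip: scaleR_conv_of_real)
    also have "\<delta> / 2 = pi / n"
      by (simp add: \<delta>_def)
    finally have "(x + y) * (R * cos (pi / n)) \<le> 1 * (R * cos (pi / n))"
      by simp
    moreover have "R * cos (pi / n) > 0"
      using assms by (intro mult_pos_pos cos_gt_zero_pi) (auto simp: field_simps intro: less_trans[of _ 0])
    ultimately have "x + y \<le> 1"
      by (simp only: mult_le_cancel_right)
    moreover have "z = c + x *\<^sub>R (?v k - c) + y *\<^sub>R (?v (Suc k) - c)"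
      using zc by (simp add: algebra_simps)
    ultimately have "z \<in> central_triangle c R \<theta> n k"
      unfolding central_triangle_def convex_hull_3_alt using xy by blast
    then show "z \<in> ?U"
      using k by blast
  qed
qed

lemma measure_convex_hull_regular:
  assumes "n > 2" "R > 0"
  shows "measure lebesgue (convex hull (regular_vertex c R \<theta> n ` {..<n})) = n * R\<^sup>2 * sin (2 * pi / n) / 2"
proof -
  have "measure lebesgue (\<Union>k<n. central_triangle c R \<theta> n k)
      = (\<Sum>k<n. measure lebesgue (central_triangle c R \<theta> n k))"
  proof (rule measure_negligible_finite_Union_image)
    show "central_triangle c R \<theta> n k \<in> lmeasurable" for k
      unfolding central_triangle_def
      by (intro lmeasurable_compact finite_imp_compact_convex_hull) auto
    have "negligible (central_triangle c R \<theta> n j \<inter> central_triangle c R \<theta> n k)"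
      if "j < n" "k < n" "j \<noteq> k" for j k
      using negligible_central_triangle_Int[of j k n R c \<theta>]
        negligible_central_triangle_Int[of k j n R c \<theta>] that assms
      by (cases "j < k") (auto simp: Int_commute)
    then show "pairwise (\<lambda>j k. negligible (central_triangle c R \<theta> n j \<inter> central_triangle c R \<theta> n k)) {..<n}"
      by (auto simp: pairwise_def)
  qed simp
  then show ?thesis
    by (simp add: convex_hull_regular_eq assms measure_central_triangle)
qed

section \<open>Side length and elimination of the circumradius\<close>

text \<open>A chord is perpendicular to the direction \<open>b\<close> bisecting its endpoints; in
  this form its length can be read off.\<close>

lemma cis_add_minus_cis_diff: "cis (b + h) - cis (b - h) = of_real (2 * sin h) * (\<i> * cis b)"
  by (simp add: complex_eq_iff cos_add cos_diff sin_add sin_diff)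

lemma dist_regular_vertex_Suc:
  assumes "n > 2" "R > 0"
  shows "dist (regular_vertex c R \<theta> n k) (regular_vertex c R \<theta> n (Suc k)) = 2 * R * sin (pi / n)"
proof -
  define a where "a = \<theta> + 2 * pi * real k / real n"
  define h where "h = pi / n"
  have h: "sin h \<ge> 0"
    using assms unfolding h_def by (intro sin_ge_zero) (auto simp: field_simps)
  \<comment> \<open>Both angles are centred at the bisecting direction \<open>a + h\<close>, where
    \<open>h\<close> is half the central angle.\<close>
  have "regular_vertex c R \<theta> n k = c + of_real R * cis ((a + h) - h)"
       "regular_vertex c R \<theta> n (Suc k) = c + of_real R * cis ((a + h) + h)"
    by (simp_all add: regular_vertex_def a_def h_def add_divide_distrib distrib_left add_ac)
  then have "regular_vertex c R \<theta> n (Suc k) - regular_vertex c R \<theta> n k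
      = of_real R * (cis ((a + h) + h) - cis ((a + h) - h))"
    by (simp add: algebra_simps)
  also have "\<dots> = of_real R * (of_real (2 * sin h) * (\<i> * cis (a + h)))"
    by (simp only: cis_add_minus_cis_diff)
  finally show ?thesis
    using h assms by (simp add: dist_norm norm_minus_commute[of "regular_vertex c R \<theta> n k"]
        norm_mult flip: h_def)
qed

lemma regular_polygon_area:
  assumes "regular_polygon n v"
  shows "convex_polygon_area n v = (polygon_perimeter n v)\<^sup>2 / (4 * (n * tan (pi / n)))"
proof -
  from assms obtain c R \<theta> where n: "n > 2" and R: "R > 0"
    and v: "\<And>k. k < n \<Longrightarrow> v k = regular_vertex c R \<theta> n k"
    by (auto simp: regular_polygon_def regular_vertex_def)
  have "dist (v k) (v (Suc k mod n)) = 2 * R * sin (pi / n)" if "k < n" for k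
    using that n R by (simp add: v regular_vertex_mod dist_regular_vertex_Suc)
  then have per: "polygon_perimeter n v = n * (2 * R * sin (pi / n))"
    by (simp add: polygon_perimeter_def)
  have "v ` {..<n} = regular_vertex c R \<theta> n ` {..<n}"
    using v by (intro image_cong) auto
  then have "convex_polygon_area n v = n * R\<^sup>2 * sin (2 * (pi / n)) / 2"
    using n R by (simp add: convex_polygon_area_def measure_convex_hull_regular)
  also have "\<dots> = n * R\<^sup>2 * (sin (pi / n) * cos (pi / n))"
    by (simp only: sin_double)
  finally have area: "convex_polygon_area n v = n * R\<^sup>2 * (sin (pi / n) * cos (pi / n))" .
  \<comment> \<open>With s and t the sine and cosine of pi/n, the claim is n R^2 s t = (2 n R s)^2 /
    (4 n s / t), which requires cancelling s.\<close>
  have "sin (pi / n) > 0"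
    using n by (intro sin_gt_zero) (auto simp: field_simps)
  then show ?thesis
    unfolding area per tan_def using n by (simp add: power2_eq_square field_simps)
qed

section \<open>Comparison with the circle and the limits\<close>

text \<open>The function tan x - x vanishes at 0 and has derivative 1 / cos^2 - 1, which is positive
  inside the interval.\<close>

lemma tan_gt_self:
  assumes "0 < x" "x < pi / 2"
  shows "x < tan x"
proof -
  have cos: "cos u > 0" if "0 \<le> u" "u \<le> x" for u
    using that assms by (intro cos_gt_zero_pi) auto
  have "tan 0 - 0 < tan x - x"
  proof (rule DERIV_pos_imp_increasing_open[OF assms(1)])
    fix u assume u: "0 < u" "u < x"
    have "((\<lambda>x. tan x - x) has_real_derivative inverse ((cos u)\<^sup>2) - 1) (at u)"
      using cos[of u] u by (auto intro!: derivative_eq_intros)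
    moreover have "cos u < cos 0"
      using u assms by (intro cos_monotone_0_pi) auto
    then have "(cos u)\<^sup>2 < 1"
      using cos[of u] u by (simp add: power_less_one_iff)
    then have "inverse ((cos u)\<^sup>2) - 1 > 0"
      using cos[of u] u by (simp add: one_less_inverse_iff)
    ultimately show "\<exists>y. ((\<lambda>x. tan x - x) has_real_derivative y) (at u) \<and> y > 0"
      by blast
  next
    show "continuous_on {0..x} (\<lambda>x. tan x - x)"
      using cos by (intro continuous_intros) (fastforce simp: less_imp_neq)
  qed
  then show ?thesis by simp
qed

text \<open>With h = pi/n this is tan h / h tending to 1 as h tends to 0.\<close>

lemma tendsto_inverse_n_tan: "(\<lambda>n. 1 / (real n * tan (pi / real n))) \<longlonglongrightarrow> 1 / pi"
  unfolding inverse_eq_divide[symmetric] by real_asymp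

theorem mainTheorem1:
  fixes p r Acircle :: real
    and c :: complex
    and P :: "nat \<Rightarrow> nat \<Rightarrow> complex"
    and A W :: "nat \<Rightarrow> real"
  assumes "p > 0"
    and "\<And>n. n > 2 \<Longrightarrow> regular_polygon n (P n)"
    and "\<And>n. n > 2 \<Longrightarrow> polygon_perimeter n (P n) = p"
    and "\<And>n. n > 2 \<Longrightarrow> A n = convex_polygon_area n (P n)"
    and "r > 0"
    and "curve_length (circlepath c r) = p"
    and "Acircle = measure lebesgue (cball c r)"
    and "\<And>n. n > 2 \<Longrightarrow> W n = Acircle - A n"
  shows "Acircle = p\<^sup>2 / (4 * pi)
    \<and> (\<forall>n>2. W n = p\<^sup>2 / 4 * (1 / pi - 1 / (real n * tan (pi / real n))) \<and> A n < Acircle)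
    \<and> W \<longlonglongrightarrow> 0
    \<and> A \<longlonglongrightarrow> p\<^sup>2 / (4 * pi)"
proof -
  \<comment> \<open>The circumference determines the radius, so the disc area pi r^2 can be
    expressed by \<open>p\<close>.\<close>
  have p: "p = 2 * pi * r"
    using assms(5,6) by (simp add: curve_length_circlepath)
  have circle: "Acircle = p\<^sup>2 / (4 * pi)"
    using assms(5,7) by (simp add: p content_cball unit_ball_vol_2 power2_eq_square)
  have A: "A n = p\<^sup>2 / 4 * (1 / (real n * tan (pi / real n)))" if "n > 2" for n
    using regular_polygon_area[OF assms(2)] assms(3,4) that by simp
  have W: "W n = p\<^sup>2 / 4 * (1 / pi - 1 / (real n * tan (pi / real n)))" if "n > 2" for n
    using A that assms(8) by (simp add: circle right_diff_distrib)
  have less: "A n < Acircle" if "n > 2" for n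
  proof -
    \<comment> \<open>For n > 2 the angle pi/n is below pi/2, as \<open>tan_gt_self\<close>
      requires.\<close>
    have "pi / n < tan (pi / n)"
      using that by (intro tan_gt_self) (auto simp: field_simps)
    then have "pi < real n * tan (pi / n)"
      using that by (simp add: field_simps)
    then have "1 / (real n * tan (pi / n)) < 1 / pi"
      by (intro divide_strict_left_mono) (auto intro: mult_pos_pos less_trans[OF pi_gt_zero])
    then have "p\<^sup>2 / 4 * (1 / (real n * tan (pi / n))) < p\<^sup>2 / 4 * (1 / pi)"
      using assms(1) by (intro mult_strict_left_mono) auto
    then show ?thesis
      using A[OF that] circle by simp
  qed
  \<comment> \<open>The closed form of \<open>A\<close> is known only from index 3 on, which
    suffices for the limit; the same holds for \<open>W\<close> below.\<close>
  have "A \<longlonglongrightarrow> p\<^sup>2 / 4 * (1 / pi)"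
    using tendsto_mult_left[OF tendsto_inverse_n_tan, of "p\<^sup>2 / 4"]
    by (rule Lim_transform_eventually)
      (use A in \<open>auto intro!: eventually_sequentiallyI[of 3]\<close>)
  then have limA: "A \<longlonglongrightarrow> Acircle"
    by (simp add: circle)
  have "(\<lambda>n. Acircle - A n) \<longlonglongrightarrow> 0"
    using tendsto_diff[OF tendsto_const limA, of Acircle] by simp
  then have "W \<longlonglongrightarrow> 0"
    by (rule Lim_transform_eventually)
      (use assms(8) in \<open>auto intro!: eventually_sequentiallyI[of 3]\<close>)
  with limA circle W less show ?thesis
    by simp
qed

end
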